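(* Let $f\in\mathcal{B}$ with power series $f(z)=\sum_{n=0}^{\infty} a_n z^n$ in $\mathbb{D}$, and put $f_0(z)=f(z)-a_0$. Then $$\sum_{n=0}^\infty |a_n|r^n+\left(\frac{1}{1+|a_0|}+\frac{r}{1-r}\right)\|f_0\|_r^2\leq 1\quad\text{for all } 0\le r\leq\frac{1}{2+|a_0|},\qquad (1)$$ and the numbers $\frac{1}{2+|a_0|}$ and $\frac{1}{1+|a_0|}$ cannot be improved. Moreover, $$|a_0|^2+\sum_{n=1}^\infty |a_n|r^n+\left(\frac{1}{1+|a_0|}+\frac{r}{1-r}\right)\|f_0\|_r^2\leq 1\quad\text{for all } 0\le r\leq\frac12,\qquad (2)$$ and the numbers $\frac12$ and $\frac{1}{1+|a_0|}$ cannot be improved. Here "cannot be improved" means the following. (i) For (1): for each $a\in[0,1)$ and each $R\in\left(\frac{1}{2+a},1\right)$, there exist $f\in\mathcal{B}$ with $|a_0|=a$ and $r\in[0,R]$ for which the inequality in (1) fails; and for each $a\in[0,1)$ and each real $\lambda>\frac{1}{1+a}$, there exist $f\in\mathcal{B}$ with $|a_0|=a$ and $r\in\left[0,\frac{1}{2+a}\right]$ such that the inequality in (1) with $\frac{1}{1+|a_0|}$ replaced by $\lambda$ fails. (ii) For (2): for each $R\in\left(\frac12,1\right)$, there exist $f\in\mathcal{B}$ and $r\in[0,R]$ for which the inequality in (2) fails; and for each $a\in[0,1)$ and each real $\lambda>\frac{1}{1+a}$, there exist $f\in\mathcal{B}$ with $|a_0|=a$ and $r\in\left[0,\frac12\right]$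 such that the inequality in (2) with $\frac{1}{1+|a_0|}$ replaced by $\lambda$ fails.
   Context: $\mathbb{D}=\{z\in\mathbb{C}: |z|<1\}$ is the open unit disk, and $\mathcal{B}$ is the class of all analytic functions $f$ in $\mathbb{D}$ with $|f(z)|\leq 1$ for all $z\in\mathbb{D}$. For $g(z)=\sum_{n=0}^{\infty}b_nz^n$ analytic in $\mathbb{D}$ and $r\in[0,1)$, the notation $\|g\|_r^2$ means $\|g\|_r^2=\sum_{n=0}^{\infty}|b_n|^2r^{2n}$; thus $\|f_0\|_r^2=\sum_{n=1}^{\infty}|a_n|^2r^{2n}$. *)

theory Defs
  imports "HOL-Complex_Analysis.Complex_Analysis"
begin

definition schur_class :: "(complex \<Rightarrow> complex) set" where
  "schur_class = {f. f analytic_on ball 0 1 \<and> (\<forall>z\<in>ball 0 1. cmod (f z) \<le> 1)}"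

abbreviation pcoeff :: "(complex \<Rightarrow> complex) \<Rightarrow> nat \<Rightarrow> complex" where
  "pcoeff f n \<equiv> fps_nth (fps_expansion f 0) n"

lemma pcoeff_sums:
  assumes "f analytic_on ball 0 1" and "z \<in> ball 0 1"
  shows "(\<lambda>n. pcoeff f n * z ^ n) sums f z"
proof -
  have "f holomorphic_on ball 0 1"
    using assms(1) by (rule analytic_imp_holomorphic)
  from holomorphic_power_series[OF this assms(2)] show ?thesis
    by (simp add: fps_expansion_def)
qed

definition norm_sq :: "(complex \<Rightarrow> complex) \<Rightarrow> real \<Rightarrow> real" where
  "norm_sq g r = (\<Sum>n. (cmod (pcoeff g n))\<^sup>2 * r ^ (2 * n))"

definition f_minus_const :: "(complex \<Rightarrow> complex) \<Rightarrow> complex \<Rightarrow> complex" where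
  "f_minus_const f = (\<lambda>z. f z - pcoeff f 0)"

text \<open>
  The left-hand sides of the two inequalities. The parameter \<open>c\<close> stands for
  the constant \<open>1 / (1 + \<bar>a\<^sub>0\<bar>)\<close>, which the sharpness claims replace
  by a larger number. All series converge for \<open>0 \<le> r < 1\<close> and \<open>f\<close> in the class.
\<close>

definition bohr_lhs1 :: "(complex \<Rightarrow> complex) \<Rightarrow> real \<Rightarrow> real \<Rightarrow> real" where
  "bohr_lhs1 f c r =
     (\<Sum>n. cmod (pcoeff f n) * r ^ n)
     + (c + r / (1 - r)) * norm_sq (f_minus_const f) r"

definition bohr_lhs2 :: "(complex \<Rightarrow> complex) \<Rightarrow> real \<Rightarrow> real \<Rightarrow> real" where
  "bohr_lhs2 f c r =
     (cmod (pcoeff f 0))\<^sup>2 + (\<Sum>n. cmod (pcoeff f (Suc n)) * r ^ Suc n)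
     + (c + r / (1 - r)) * norm_sq (f_minus_const f) r"

end

(*
  Carlson's inequalities bound |a_(2n+1)| and |a_(2n)| by 1 minus sums of |a_j|^2, j <= n.
  They follow from the fact that multiplication by f is a contraction of the Hardy space,
  applied to polynomials whose upper coefficients are the reversed conjugates of
  a_0, ..., a_n, turned by a unimodular factor into the direction of the coefficient to be
  bounded. Multiplying by r^n and summing, the |a_j|^2 terms assemble into the weight
  1/(1+|a_0|) + r/(1-r), and what remains is

    sum_{n>=1} |a_n| r^n + (1/(1+|a_0|) + r/(1-r)) ||f_0||_r^2 <= (1-|a_0|^2) r/(1-r).

  Both parts of the theorem are read off from this. For the Moebius map
  (z - a)/(1 - a z) it is an equality, which gives every sharpness claim.
*)

theory Submission
  imports Defs
begin

section \<open>Discrete Parseval identity\<close>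

text \<open>The summand is the \<open>j\<close>-th power of one \<open>M\<close>-th root of unity
  \<open>q\<close> with argument proportional to \<open>k - l\<close>, so the geometric sum vanishes
  unless \<open>q = 1\<close>. Since \<open>k\<close> and \<open>l\<close> lie below
  \<open>M\<close>, that happens only for \<open>k = l\<close>.\<close>

lemma sum_roots_of_unity_orthogonal:
  fixes k l M :: nat
  assumes "k < M" "l < M"
  shows "(\<Sum>j<M. cis (2 * pi * real j / real M) ^ k * cnj (cis (2 * pi * real j / real M) ^ l))
           = (if k = l then of_nat M else 0)"
proof -
  define q where "q = cis (2 * pi * (real k - real l) / real M)"
  have M: "M > 0" using assms by simp
  have "cis (2 * pi * real j / real M) ^ k * cnj (cis (2 * pi * real j / real M) ^ l) = q ^ j" for j
    unfolding q_def complex_cnj_power cis_cnj Complex.DeMoivre cis_mult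
    by (rule arg_cong[where f = cis]) (simp add: diff_divide_distrib algebra_simps)
  then have *: "(\<Sum>j<M. cis (2 * pi * real j / real M) ^ k * cnj (cis (2 * pi * real j / real M) ^ l))
      = (\<Sum>j<M. q ^ j)" by simp
  show ?thesis
  proof (cases "k = l")
    case True
    then show ?thesis unfolding * by (simp add: q_def)
  next
    case False
    have "q ^ M = cis (2 * pi * of_int (int k - int l))"
      using M by (simp add: q_def Complex.DeMoivre)
    then have qM: "q ^ M = 1"
      by (metis cis_multiple_2pi Ints_of_int)
    \<comment> \<open>If \<open>q = 1\<close>, its angle is a multiple of \<open>2 * pi\<close>, so
      \<open>M\<close> divides \<open>k - l\<close>; but 0 < |k - l| < M.\<close>
    have "q \<noteq> 1"
    proof
      assume "q = 1"
      then have "cos (2 * pi * (real k - real l) / real M) = 1"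
        by (metis q_def cis.sel(1) one_complex.sel(1))
      then obtain n :: int where "2 * pi * (real k - real l) / real M = of_int n * 2 * pi"
        by (auto simp: cos_one_2pi_int)
      then have "2 * pi * (real k - real l) = of_int n * 2 * pi * real M"
        using M by (simp only: nonzero_divide_eq_eq of_nat_0_eq_iff neq0_conv not_False_eq_True)
      also have "\<dots> = 2 * pi * (of_int n * real M)" by (simp only: mult_ac)
      finally have "real k - real l = of_int n * real M"
        by (subst (asm) mult_left_cancel) auto
      then have "of_int (int k - int l) = (of_int (n * int M) :: real)"
        by simp
      then have "int k - int l = n * int M"
        by (simp only: of_int_eq_iff)
      then have "int M dvd int k - int l" by simp
      then have "\<bar>int k - int l\<bar> \<ge> int M"
        using dvd_imp_le_int[of "int k - int l" "int M"] False by simp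
      then show False using assms by linarith
    qed
    then show ?thesis unfolding * using qM False by (simp add: sum_gp_strict)
  qed
qed

text \<open>A finite substitute for the mean square over the unit circle: after expanding the
  squares, orthogonality removes the cross terms. The condition \<open>K < M\<close> keeps the
  exponents distinct modulo \<open>M\<close>.\<close>

lemma parseval_roots_of_unity:
  fixes c :: "nat \<Rightarrow> complex"
  assumes "K < M"
  shows "(\<Sum>j<M. (cmod (\<Sum>k\<le>K. c k * cis (2 * pi * real j / real M) ^ k))\<^sup>2)
           = real M * (\<Sum>k\<le>K. (cmod (c k))\<^sup>2)"
proof -
  define w where "w j = cis (2 * pi * real j / real M)" for j :: nat
  have "of_real (\<Sum>j<M. (cmod (\<Sum>k\<le>K. c k * w j ^ k))\<^sup>2)
      = (\<Sum>j<M. \<Sum>k\<le>K. \<Sum>l\<le>K. (c k * cnj (c l)) * (w j ^ k * cnj (w j ^ l)))"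
    unfolding of_real_sum complex_norm_square cnj_sum sum_product
    by (intro sum.cong) (simp_all add: mult_ac)
  also have "\<dots> = (\<Sum>k\<le>K. \<Sum>l\<le>K. (c k * cnj (c l)) * (\<Sum>j<M. w j ^ k * cnj (w j ^ l)))"
    unfolding sum_distrib_left by (subst sum.swap, rule sum.cong[OF refl], subst sum.swap) simp
  also have "\<dots> = (\<Sum>k\<le>K. \<Sum>l\<le>K. if l = k then of_nat M * (c k * cnj (c l)) else 0)"
    using assms by (intro sum.cong refl, unfold w_def, subst sum_roots_of_unity_orthogonal) auto
  also have "\<dots> = (\<Sum>k\<le>K. of_nat M * (c k * cnj (c k)))"
    by (simp add: sum.delta)
  also have "\<dots> = of_real (real M * (\<Sum>k\<le>K. (cmod (c k))\<^sup>2))"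
    unfolding of_real_mult of_real_sum complex_norm_square sum_distrib_left by simp
  finally show ?thesis
    unfolding w_def of_real_eq_iff .
qed

text \<open>Both sides are averaged over the \<open>M\<close>-th roots of unity, with
  \<open>M\<close> above both degrees. On the circle the second polynomial is at most
  \<open>B\<close>, so squaring the hypothesis costs at most \<open>e * (2 * B + e)\<close>. The
  slack \<open>e\<close> will absorb the tail of a truncated power series.\<close>

lemma sum_norm_sq_le_of_uniform_bound:
  fixes c d :: "nat \<Rightarrow> complex"
  assumes le: "\<And>z. cmod z = 1 \<Longrightarrow>
      cmod (\<Sum>k\<le>K. c k * z ^ k) \<le> cmod (\<Sum>k\<le>N. d k * z ^ k) + e"
    and e: "e \<ge> 0" and B: "(\<Sum>k\<le>N. cmod (d k)) \<le> B"
  shows "(\<Sum>k\<le>K. (cmod (c k))\<^sup>2) \<le> (\<Sum>k\<le>N. (cmod (d k))\<^sup>2) + e * (2 * B + e)"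
proof -
  define M where "M = Suc (max K N)"
  define w where "w j = cis (2 * pi * real j / real M)" for j :: nat
  have M: "K < M" "N < M" "M > 0" by (auto simp: M_def)
  have w: "cmod (w j) = 1" for j by (simp add: w_def)
  have "real M * (\<Sum>k\<le>K. (cmod (c k))\<^sup>2) = (\<Sum>j<M. (cmod (\<Sum>k\<le>K. c k * w j ^ k))\<^sup>2)"
    unfolding w_def by (rule parseval_roots_of_unity[symmetric]) fact
  also have "\<dots> \<le> (\<Sum>j<M. (cmod (\<Sum>k\<le>N. d k * w j ^ k))\<^sup>2 + e * (2 * B + e))"
  proof (rule sum_mono)
    fix j
    let ?x = "cmod (\<Sum>k\<le>K. c k * w j ^ k)" and ?y = "cmod (\<Sum>k\<le>N. d k * w j ^ k)"
    have "?y \<le> (\<Sum>k\<le>N. cmod (d k * w j ^ k))" by (rule norm_sum)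
    also have "\<dots> \<le> B" using B by (simp add: norm_mult norm_power w)
    finally have y: "?y \<le> B" .
    have "?x\<^sup>2 \<le> (?y + e)\<^sup>2" using le[OF w] by (intro power_mono) auto
    also have "\<dots> = ?y\<^sup>2 + e * (2 * ?y + e)" by (simp add: power2_eq_square algebra_simps)
    also have "\<dots> \<le> ?y\<^sup>2 + e * (2 * B + e)"
      using y e by (intro add_left_mono mult_left_mono) auto
    finally show "?x\<^sup>2 \<le> ?y\<^sup>2 + e * (2 * B + e)" .
  qed
  also have "\<dots> = real M * ((\<Sum>k\<le>N. (cmod (d k))\<^sup>2) + e * (2 * B + e))"
    unfolding sum.distrib w_def
    by (subst parseval_roots_of_unity[OF M(2)]) (simp add: algebra_simps)
  finally show ?thesis using M by simp
qed

section \<open>Multiplication by a Schur function as a contraction\<close>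

lemma schur_class_sums:
  assumes "f \<in> schur_class" "cmod z < 1"
  shows "(\<lambda>n. pcoeff f n * z ^ n) sums f z"
  using assms pcoeff_sums[of f z] by (auto simp: schur_class_def)

lemma schur_class_summable_norm:
  assumes f: "f \<in> schur_class" and z: "cmod z < 1"
  shows "summable (\<lambda>n. cmod (pcoeff f n * z ^ n))"
proof -
  \<comment> \<open>Convergence at the larger radius \<open>s\<close> gives absolute convergence at
    \<open>z\<close>.\<close>
  obtain s where s: "cmod z < s" "s < 1" using z dense by blast
  then have s0: "s > 0" by (meson norm_ge_zero le_less_trans)
  have "summable (\<lambda>n. pcoeff f n * (of_real s) ^ n)"
    using schur_class_sums[OF f, of "of_real s"] s s0 by (auto simp: sums_iff)
  then show ?thesis by (rule powser_insidea) (use s s0 in simp)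
qed

lemma schur_class_product_sums:
  assumes f: "f \<in> schur_class" and d: "\<And>k. k > N \<Longrightarrow> d k = 0" and z: "cmod z < 1"
  shows "(\<lambda>k. (\<Sum>i\<le>k. pcoeff f i * d (k - i)) * z ^ k) sums (f z * (\<Sum>k\<le>N. d k * z ^ k))"
proof -
  have dsums: "(\<lambda>k. d k * z ^ k) sums (\<Sum>k\<le>N. d k * z ^ k)"
    by (rule sums_finite) (use d in auto)
  have "summable (\<lambda>k. cmod (d k * z ^ k))"
    by (rule summable_finite[of "{..N}"]) (use d in auto)
  from Cauchy_product_sums[OF schur_class_summable_norm[OF f z] this]
  have "(\<lambda>k. \<Sum>i\<le>k. pcoeff f i * z ^ i * (d (k - i) * z ^ (k - i)))
      sums (f z * (\<Sum>k\<le>N. d k * z ^ k))"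
    using schur_class_sums[OF f z] dsums by (simp add: sums_iff)
  moreover have "(\<Sum>i\<le>k. pcoeff f i * z ^ i * (d (k - i) * z ^ (k - i)))
      = (\<Sum>i\<le>k. pcoeff f i * d (k - i)) * z ^ k" for k
    unfolding sum_distrib_right
  proof (rule sum.cong[OF refl])
    fix i assume "i \<in> {..k}"
    then have "z ^ k = z ^ i * z ^ (k - i)" by (simp flip: power_add)
    then show "pcoeff f i * z ^ i * (d (k - i) * z ^ (k - i)) = pcoeff f i * d (k - i) * z ^ k"
      by simp
  qed
  ultimately show ?thesis by simp
qed

text \<open>On the circle of radius \<open>r\<close> the product of \<open>f\<close> and the
  polynomial with coefficients \<open>d\<close> is bounded in modulus by that polynomial, and mean
  squares inherit the inequality. The product is an infinite series, so it is first cut off with an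
  error \<open>e\<close> that is sent to 0 afterwards.\<close>

lemma schur_class_toeplitz_contraction_radius:
  assumes f: "f \<in> schur_class" and d: "\<And>k. k > N \<Longrightarrow> d k = 0" and r: "0 \<le> r" "r < 1"
  shows "(\<Sum>k\<le>N. (cmod (\<Sum>i\<le>k. pcoeff f i * d (k - i)))\<^sup>2 * r ^ (2 * k))
           \<le> (\<Sum>k\<le>N. (cmod (d k))\<^sup>2)"
proof -
  define g where "g k = (\<Sum>i\<le>k. pcoeff f i * d (k - i))" for k
  define B where "B = (\<Sum>k\<le>N. cmod (d k * of_real r ^ k))"
  have gsum: "(\<lambda>k. g k * z ^ k) sums (f z * (\<Sum>k\<le>N. d k * z ^ k))" if "cmod z < 1" for z
    unfolding g_def by (rule schur_class_product_sums[OF f d that])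
  obtain s where s: "r < s" "s < 1" using r dense by blast
  have "summable (\<lambda>k. g k * (of_real s) ^ k)"
    using gsum[of "of_real s"] s r by (auto simp: sums_iff)
  then have gabs: "summable (\<lambda>k. cmod (g k * (of_real r) ^ k))"
    by (rule powser_insidea) (use s r in simp)
  have eps: "(\<Sum>k\<le>N. (cmod (g k * of_real r ^ k))\<^sup>2) \<le>
      (\<Sum>k\<le>N. (cmod (d k * of_real r ^ k))\<^sup>2) + e * (2 * B + e)" if e: "e > 0" for e
  proof -
    obtain K0 where K0: "\<And>n. n \<ge> K0 \<Longrightarrow> norm (\<Sum>i. cmod (g (i + n) * of_real r ^ (i + n))) < e"
      using suminf_exist_split[OF e gabs] by blast
    \<comment> \<open>Beyond \<open>K\<close> the tail is below \<open>e\<close>, uniformly on the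
      circle; \<open>K\<close> at least \<open>N\<close> retains every coefficient that the claim
      mentions.\<close>
    define K where "K = max K0 N"
    have tail: "(\<Sum>i. cmod (g (i + Suc K) * of_real r ^ (i + Suc K))) < e"
      using K0[of "Suc K"] unfolding real_norm_def
      by (rule abs_less_iff[THEN iffD1, THEN conjunct1]) (simp add: K_def)
    have "(\<Sum>k\<le>N. (cmod (g k * of_real r ^ k))\<^sup>2) \<le> (\<Sum>k\<le>K. (cmod (g k * of_real r ^ k))\<^sup>2)"
      by (rule sum_mono2) (auto simp: K_def)
    also have "\<dots> \<le> (\<Sum>k\<le>N. (cmod (d k * of_real r ^ k))\<^sup>2) + e * (2 * B + e)"
    proof (rule sum_norm_sq_le_of_uniform_bound)
      fix z :: complex assume z: "cmod z = 1"
      let ?u = "of_real r * z"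
      have u: "cmod ?u < 1" using z r by (simp add: norm_mult)
      have eq: "a * of_real r ^ k * z ^ k = a * ?u ^ k" for a k
        by (simp add: power_mult_distrib)
      have abs: "summable (\<lambda>i. cmod (g (i + Suc K) * ?u ^ (i + Suc K)))"
        using gabs[THEN summable_ignore_initial_segment, of "Suc K"] z
        by (simp add: norm_mult norm_power power_mult_distrib)
      have "f ?u * (\<Sum>k\<le>N. d k * ?u ^ k)
          = (\<Sum>i. g (i + Suc K) * ?u ^ (i + Suc K)) + (\<Sum>k\<le>K. g k * ?u ^ k)"
        using gsum[OF u] suminf_split_initial_segment[of "\<lambda>k. g k * ?u ^ k" "Suc K"]
        by (simp add: sums_iff lessThan_Suc_atMost)
      then have "(\<Sum>k\<le>K. g k * ?u ^ k) = f ?u * (\<Sum>k\<le>N. d k * ?u ^ k)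
          - (\<Sum>i. g (i + Suc K) * ?u ^ (i + Suc K))" by simp
      then have "cmod (\<Sum>k\<le>K. g k * ?u ^ k) \<le> cmod (f ?u * (\<Sum>k\<le>N. d k * ?u ^ k))
          + cmod (\<Sum>i. g (i + Suc K) * ?u ^ (i + Suc K))"
        by (simp only: norm_triangle_ineq4)
      also have "cmod (\<Sum>i. g (i + Suc K) * ?u ^ (i + Suc K))
          \<le> (\<Sum>i. cmod (g (i + Suc K) * ?u ^ (i + Suc K)))"
        by (rule summable_norm[OF abs])
      also have "\<dots> = (\<Sum>i. cmod (g (i + Suc K) * of_real r ^ (i + Suc K)))"
        using z by (simp add: norm_mult norm_power power_mult_distrib)
      also have "\<dots> \<le> e" using tail by simp
      also have "cmod (f ?u * (\<Sum>k\<le>N. d k * ?u ^ k)) \<le> 1 * cmod (\<Sum>k\<le>N. d k * ?u ^ k)"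
        unfolding norm_mult using f u by (intro mult_right_mono) (auto simp: schur_class_def)
      finally show "cmod (\<Sum>k\<le>K. g k * of_real r ^ k * z ^ k)
          \<le> cmod (\<Sum>k\<le>N. d k * of_real r ^ k * z ^ k) + e"
        unfolding eq by simp
    qed (use e in \<open>auto simp: B_def\<close>)
    finally show ?thesis .
  qed
  \<comment> \<open>\<open>B\<close> does not depend on \<open>e\<close>, so the error term
    disappears in the limit.\<close>
  have "((\<lambda>e. (\<Sum>k\<le>N. (cmod (d k * of_real r ^ k))\<^sup>2) + e * (2 * B + e)) \<longlongrightarrow>
      (\<Sum>k\<le>N. (cmod (d k * of_real r ^ k))\<^sup>2) + 0 * (2 * B + 0)) (at_right 0)"
    by (intro tendsto_intros)
  then have "(\<Sum>k\<le>N. (cmod (g k * of_real r ^ k))\<^sup>2)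
      \<le> (\<Sum>k\<le>N. (cmod (d k * of_real r ^ k))\<^sup>2) + 0 * (2 * B + 0)"
    by (rule tendsto_lowerbound)
       (auto intro: eventually_mono[OF eventually_at_right_less] eps)
  also have "\<dots> \<le> (\<Sum>k\<le>N. (cmod (d k))\<^sup>2)"
    using r by (auto simp: norm_mult norm_power intro!: sum_mono power_mono mult_left_le power_le_one)
  finally show ?thesis
    using r by (simp add: g_def norm_mult norm_power power_mult_distrib power_mult mult.commute)
qed

text \<open>The lower triangular Toeplitz matrix of the coefficients of \<open>f\<close> is a
  contraction. Only finitely many terms occur, so \<open>r\<close> may tend to 1 in the weighted
  version.\<close>

lemma schur_class_toeplitz_contraction:
  assumes f: "f \<in> schur_class" and d: "\<And>k. k > N \<Longrightarrow> d k = 0"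
  shows "(\<Sum>k\<le>N. (cmod (\<Sum>i\<le>k. pcoeff f i * d (k - i)))\<^sup>2) \<le> (\<Sum>k\<le>N. (cmod (d k))\<^sup>2)"
proof -
  let ?h = "\<lambda>r::real. \<Sum>k\<le>N. (cmod (\<Sum>i\<le>k. pcoeff f i * d (k - i)))\<^sup>2 * r ^ (2 * k)"
  have "(?h \<longlongrightarrow> ?h 1) (at_left 1)"
    by (intro tendsto_intros)
  moreover have "eventually (\<lambda>r. ?h r \<le> (\<Sum>k\<le>N. (cmod (d k))\<^sup>2)) (at_left 1)"
    using eventually_at_left_real[of 0 1]
    by (auto elim!: eventually_mono intro!: schur_class_toeplitz_contraction_radius[OF f d])
  ultimately have "?h 1 \<le> (\<Sum>k\<le>N. (cmod (d k))\<^sup>2)"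
    by (rule tendsto_upperbound) simp
  then show ?thesis by simp
qed

section \<open>Carlson's inequalities\<close>

lemma unit_phase:
  fixes z :: complex
  obtains t where "cmod t = 1" "z = of_real (cmod z) * t"
proof (cases "z = 0")
  case True
  then show ?thesis using that[of 1] by simp
next
  case False
  then show ?thesis using that[of "z / of_real (cmod z)"] by (simp add: norm_divide)
qed

lemma sum_reflect_upper:
  fixes h :: "nat \<Rightarrow> 'a::comm_monoid_add"
  assumes "m \<le> N"
  shows "(\<Sum>k\<in>{N - m<..N}. h (N - k)) = (\<Sum>j<m. h j)"
  by (rule sum.reindex_bij_witness[of _ "\<lambda>j. N - j" "\<lambda>k. N - k"]) (use assms in auto)

text \<open>The test polynomial is 1 plus the reversed conjugates of a_0, ..., a_n, times
  \<open>t\<close>, at the indices n+1, ..., 2n+1; its squared norm is 1 + S. The product with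
  \<open>f\<close> still has a_0, ..., a_n as its low coefficients, and at the index N = 2n+1 the
  reversed block adds S to a_N in the direction of a_N. The contraction then reads S + (|a_N| + S)^2
  <= 1 + S.\<close>

lemma carlson_odd:
  assumes f: "f \<in> schur_class"
  shows "cmod (pcoeff f (2 * n + 1)) \<le> 1 - (\<Sum>j\<le>n. (cmod (pcoeff f j))\<^sup>2)"
proof -
  define a where "a = pcoeff f"
  define S where "S = (\<Sum>j\<le>n. (cmod (a j))\<^sup>2)"
  define N where "N = 2 * n + 1"
  obtain t where t: "cmod t = 1" "a N = of_real (cmod (a N)) * t" by (rule unit_phase)
  define d where "d k = (if k = 0 then 1 else if n < k \<and> k \<le> N then t * cnj (a (N - k)) else 0)" for k
  define g where "g k = (\<Sum>i\<le>k. a i * d (k - i))" for k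
  have S0: "S \<ge> 0" by (simp add: S_def sum_nonneg)
  have upper: "(\<Sum>k\<in>{n<..N}. h (N - k)) = (\<Sum>j\<le>n. h j)" for h :: "nat \<Rightarrow> real"
    using sum_reflect_upper[of "Suc n" N h] by (simp add: N_def lessThan_Suc_atMost)
  have "(\<Sum>k\<le>N. (cmod (d k))\<^sup>2) = (\<Sum>k\<in>insert 0 {n<..N}. (cmod (d k))\<^sup>2)"
    by (rule sum.mono_neutral_right) (auto simp: d_def)
  also have "\<dots> = 1 + (\<Sum>k\<in>{n<..N}. (cmod (a (N - k)))\<^sup>2)"
    by (subst sum.insert) (auto simp: d_def norm_mult t(1) intro!: sum.cong)
  also have "\<dots> = 1 + S" unfolding S_def using upper[of "\<lambda>j. (cmod (a j))\<^sup>2"] by simp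
  finally have d_norm: "(\<Sum>k\<le>N. (cmod (d k))\<^sup>2) = 1 + S" .
  have g_low: "g k = a k" if "k \<le> n" for k
  proof -
    have "g k = (\<Sum>i\<le>k. if i = k then a i else 0)"
      unfolding g_def by (rule sum.cong) (use that in \<open>auto simp: d_def\<close>)
    then show ?thesis by simp
  qed
  \<comment> \<open>For \<open>i\<close> strictly between \<open>n\<close> and \<open>N\<close> the
    index \<open>N - i\<close> falls into the gap 1, ..., n, where \<open>d\<close> is 0.\<close>
  have "g N = (\<Sum>i\<in>insert N {..n}. a i * d (N - i))"
    unfolding g_def by (rule sum.mono_neutral_right) (auto simp: d_def N_def)
  also have "\<dots> = a N + (\<Sum>i\<le>n. a i * d (N - i))"
    by (subst sum.insert) (auto simp: d_def N_def)
  also have "(\<Sum>i\<le>n. a i * d (N - i)) = (\<Sum>i\<le>n. of_real ((cmod (a i))\<^sup>2) * t)"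
    unfolding complex_norm_square
    by (rule sum.cong) (auto simp: d_def N_def)
  also have "\<dots> = of_real S * t" by (simp add: S_def sum_distrib_right)
  also have "a N + of_real S * t = of_real (cmod (a N) + S) * t"
    by (subst t(2)) (simp add: algebra_simps)
  finally have gN: "g N = of_real (cmod (a N) + S) * t" .
  have g_N: "cmod (g N) = cmod (a N) + S"
    unfolding gN norm_mult t(1) norm_of_real using S0 by simp
  have "S + (cmod (a N) + S)\<^sup>2 = (\<Sum>k\<in>insert N {..n}. (cmod (g k))\<^sup>2)"
  proof -
    have "N \<notin> {..n}" by (simp add: N_def)
    then show ?thesis by (simp add: g_N g_low S_def)
  qed
  also have "\<dots> \<le> (\<Sum>k\<le>N. (cmod (g k))\<^sup>2)"
    by (rule sum_mono2) (auto simp: N_def)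
  also have "\<dots> \<le> (\<Sum>k\<le>N. (cmod (d k))\<^sup>2)"
    unfolding g_def a_def by (rule schur_class_toeplitz_contraction[OF f]) (auto simp: d_def N_def)
  finally have "(cmod (a N) + S)\<^sup>2 \<le> 1\<^sup>2" by (simp add: d_norm)
  then have "cmod (a N) + S \<le> 1" by (rule power2_le_imp_le) simp
  then show ?thesis by (simp add: S_def a_def N_def)
qed

text \<open>Here the reversed block holds only a_0, ..., a_(n-1), which leaves the index
  \<open>n\<close> free for an extra coefficient \<open>\<beta>\<close> of modulus \<open>b\<close>.
  It adds b^2 to the norm of \<open>d\<close>, is repaid by |g_n| >= b, and contributes b |a_n| =
  |a_n|^2 / (1 + |a_0|) at the index 2n. With n = 0 the free index would collide with the constant
  term, and unimodular constants violate the bound.\<close>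

lemma carlson_even:
  assumes f: "f \<in> schur_class" and n: "n > 0"
  shows "cmod (pcoeff f (2 * n)) \<le> 1 - (\<Sum>j<n. (cmod (pcoeff f j))\<^sup>2)
           - (cmod (pcoeff f n))\<^sup>2 / (1 + cmod (pcoeff f 0))"
proof -
  define a where "a = pcoeff f"
  define S where "S = (\<Sum>j<n. (cmod (a j))\<^sup>2)"
  define N where "N = 2 * n"
  define G where "G = cmod (a n)"
  \<comment> \<open>\<open>b\<close> solves \<open>b\<^sup>2 = (G - b * cmod (a 0))\<^sup>2\<close>, so the coefficient of index \<open>n\<close> costs nothing\<close>
  define b where "b = G / (1 + cmod (a 0))"
  obtain t where t: "cmod t = 1" "a N = of_real (cmod (a N)) * t" by (rule unit_phase)
  obtain s where s: "cmod s = 1" "a n = of_real G * s" unfolding G_def by (rule unit_phase)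
  \<comment> \<open>The phase turns \<open>a n * \<beta>\<close> into the direction
    \<open>t\<close>, so that it adds to \<open>a N\<close> without cancellation.\<close>
  define \<beta> where "\<beta> = of_real b * (t * cnj s)"
  define d where "d k = (if k = 0 then 1 else if k = n then \<beta>
      else if n < k \<and> k \<le> N then t * cnj (a (N - k)) else 0)" for k
  define g where "g k = (\<Sum>i\<le>k. a i * d (k - i))" for k
  have S0: "S \<ge> 0" by (simp add: S_def sum_nonneg)
  have G0: "G \<ge> 0" by (simp add: G_def)
  have a0: "1 + cmod (a 0) > 0" by (simp add: add_pos_nonneg)
  have b0: "b \<ge> 0" using G0 a0 by (simp add: b_def)
  have bG: "b * (1 + cmod (a 0)) = G" using a0 by (simp add: b_def)
  have \<beta>: "cmod \<beta> = b" using b0 by (simp add: \<beta>_def norm_mult t(1) s(1))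
  have \<beta>a: "a n * \<beta> = of_real (b * G) * t"
  proof -
    have "s * cnj s = 1" using s(1) by (simp add: complex_norm_square[symmetric])
    then show ?thesis unfolding \<beta>_def by (subst s(2)) (simp add: algebra_simps)
  qed
  have upper: "(\<Sum>k\<in>{n<..N}. h (N - k)) = (\<Sum>j<n. h j)" for h :: "nat \<Rightarrow> real"
    using sum_reflect_upper[of n N h] by (simp add: N_def)
  have "(\<Sum>k\<le>N. (cmod (d k))\<^sup>2) = (\<Sum>k\<in>insert 0 (insert n {n<..N}). (cmod (d k))\<^sup>2)"
    by (rule sum.mono_neutral_right) (auto simp: d_def N_def)
  also have "\<dots> = 1 + (b\<^sup>2 + (\<Sum>k\<in>{n<..N}. (cmod (d k))\<^sup>2))"
    using n by (simp add: d_def \<beta>)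
  also have "(\<Sum>k\<in>{n<..N}. (cmod (d k))\<^sup>2) = (\<Sum>k\<in>{n<..N}. (cmod (a (N - k)))\<^sup>2)"
    by (rule sum.cong) (auto simp: d_def norm_mult t(1))
  also have "\<dots> = S" unfolding S_def using upper[of "\<lambda>j. (cmod (a j))\<^sup>2"] by simp
  finally have d_norm: "(\<Sum>k\<le>N. (cmod (d k))\<^sup>2) = 1 + (b\<^sup>2 + S)" .
  have g_low: "g k = a k" if "k < n" for k
  proof -
    have "g k = (\<Sum>i\<le>k. if i = k then a i else 0)"
      unfolding g_def by (rule sum.cong) (use that in \<open>auto simp: d_def\<close>)
    then show ?thesis by simp
  qed
  have "g n = (\<Sum>i\<in>{0, n}. a i * d (n - i))"
    unfolding g_def by (rule sum.mono_neutral_right) (auto simp: d_def)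
  then have "g n = a n + a 0 * \<beta>" using n by (simp add: d_def)
  then have "cmod (g n) \<ge> cmod (a n) - cmod (a 0 * \<beta>)"
    using norm_diff_ineq by metis
  then have g_n: "cmod (g n) \<ge> b"
    using bG by (simp add: norm_mult \<beta> G_def algebra_simps)
  have "g N = (\<Sum>i\<in>insert N (insert n {..<n}). a i * d (N - i))"
    unfolding g_def by (rule sum.mono_neutral_right) (auto simp: d_def N_def)
  also have "\<dots> = a N + (a n * \<beta> + (\<Sum>i<n. a i * d (N - i)))"
    using n by (simp add: d_def N_def)
  also have "(\<Sum>i<n. a i * d (N - i)) = (\<Sum>i<n. of_real ((cmod (a i))\<^sup>2) * t)"
    unfolding complex_norm_square
    by (rule sum.cong) (auto simp: d_def N_def)
  also have "\<dots> = of_real S * t" by (simp add: S_def sum_distrib_right)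
  also have "a N + (a n * \<beta> + of_real S * t) = of_real (cmod (a N) + (b * G + S)) * t"
    unfolding \<beta>a by (subst t(2)) (simp add: algebra_simps)
  finally have gN: "g N = of_real (cmod (a N) + (b * G + S)) * t" .
  have g_N: "cmod (g N) = cmod (a N) + (b * G + S)"
    unfolding gN norm_mult t(1) norm_of_real using S0 b0 G0 by simp
  \<comment> \<open>Both S and b^2 reappear in the norm of \<open>d\<close> and cancel, leaving a
    square that is at most 1.\<close>
  have "S + (b\<^sup>2 + (cmod (a N) + (b * G + S))\<^sup>2) \<le> S + ((cmod (g n))\<^sup>2 + (cmod (g N))\<^sup>2)"
    using g_n b0 by (auto simp: g_N intro: power_mono)
  also have "\<dots> = (\<Sum>k\<in>insert N (insert n {..<n}). (cmod (g k))\<^sup>2)"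
    using n by (simp add: g_low S_def N_def)
  also have "\<dots> \<le> (\<Sum>k\<le>N. (cmod (g k))\<^sup>2)"
    by (rule sum_mono2) (auto simp: N_def)
  also have "\<dots> \<le> (\<Sum>k\<le>N. (cmod (d k))\<^sup>2)"
    unfolding g_def a_def by (rule schur_class_toeplitz_contraction[OF f]) (use n in \<open>auto simp: d_def N_def\<close>)
  finally have "(cmod (a N) + (b * G + S))\<^sup>2 \<le> 1\<^sup>2" by (simp add: d_norm)
  then have "cmod (a N) + (b * G + S) \<le> 1" by (rule power2_le_imp_le) simp
  then show ?thesis by (simp add: S_def a_def N_def b_def G_def power2_eq_square)
qed

section \<open>The refined Bohr sum\<close>

lemma pcoeff_eq_fps_nth:
  "f has_fps_expansion F \<Longrightarrow> pcoeff f n = fps_nth F n"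
  by (simp add: fps_expansion_def fps_nth_fps_expansion)

lemma pcoeff_f_minus_const:
  assumes f: "f \<in> schur_class"
  shows "pcoeff (f_minus_const f) n = (if n = 0 then 0 else pcoeff f n)"
proof -
  have "f holomorphic_on ball 0 1"
    using f by (auto simp: schur_class_def analytic_imp_holomorphic)
  then have "f has_fps_expansion fps_expansion f 0"
    by (intro has_fps_expansion_fps_expansion[of "ball 0 1"]) auto
  then have "(\<lambda>z. f z - pcoeff f 0) has_fps_expansion fps_expansion f 0 - fps_const (pcoeff f 0)"
    by (intro has_fps_expansion_diff has_fps_expansion_const)
  from pcoeff_eq_fps_nth[OF this, of n] show ?thesis
    unfolding f_minus_const_def by simp
qed

lemma norm_sq_f_minus_const:
  assumes f: "f \<in> schur_class"
  shows "norm_sq (f_minus_const f) r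
           = (\<Sum>n. if n = 0 then 0 else (cmod (pcoeff f n))\<^sup>2 * r ^ (2 * n))"
  unfolding norm_sq_def by (rule arg_cong[where f = suminf]) (auto simp: pcoeff_f_minus_const[OF f])

text \<open>Carlson's inequalities contain this bound for positive indices; the index 0 is the value
  of \<open>f\<close> at the origin. It provides the geometric majorant for the squared coefficients
  and the bound |a_0| <= 1.\<close>

lemma schur_class_pcoeff_le_1:
  assumes f: "f \<in> schur_class"
  shows "cmod (pcoeff f n) \<le> 1"
proof (cases "odd n")
  case True
  then obtain m where n: "n = 2 * m + 1" by (elim oddE)
  have "(\<Sum>j\<le>m. (cmod (pcoeff f j))\<^sup>2) \<ge> 0" by (simp add: sum_nonneg)
  then show ?thesis using carlson_odd[OF f, of m] unfolding n by linarith
next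
  case False
  show ?thesis
  proof (cases "n = 0")
    case True
    have "f 0 = pcoeff f 0" by (simp add: fps_expansion_def)
    moreover have "cmod (f 0) \<le> 1" using f by (auto simp: schur_class_def)
    ultimately show ?thesis using True by simp
  next
    case n0: False
    from False obtain m where n: "n = 2 * m" by auto
    have "(\<Sum>j<m. (cmod (pcoeff f j))\<^sup>2) \<ge> 0" by (simp add: sum_nonneg)
    moreover have "(cmod (pcoeff f m))\<^sup>2 / (1 + cmod (pcoeff f 0)) \<ge> 0"
      by (intro divide_nonneg_nonneg) auto
    ultimately show ?thesis using carlson_even[OF f, of m] n0 unfolding n by linarith
  qed
qed

lemma schur_class_summable_power:
  assumes f: "f \<in> schur_class" and r: "0 \<le> r" "r < 1"
  shows "summable (\<lambda>n. cmod (pcoeff f n) * r ^ n)"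
  using schur_class_summable_norm[OF f, of "of_real r"] r by (simp add: norm_mult norm_power)

lemma schur_class_summable_square:
  assumes f: "f \<in> schur_class" and r: "0 \<le> r" "r < 1"
  shows "summable (\<lambda>n. (cmod (pcoeff f n))\<^sup>2 * r ^ (2 * n))"
proof (rule summable_comparison_test)
  have "r\<^sup>2 < 1" using r by (simp add: abs_square_less_1)
  then show "summable (\<lambda>n. (r\<^sup>2) ^ n)" by (simp add: summable_geometric)
  show "\<exists>N. \<forall>n\<ge>N. norm ((cmod (pcoeff f n))\<^sup>2 * r ^ (2 * n)) \<le> (r\<^sup>2) ^ n"
    using r schur_class_pcoeff_le_1[OF f]
    by (auto simp: power_mult abs_mult intro!: mult_right_le_one_le mult_left_le_one_le power_le_one)
qed

text \<open>The terms are paired as 2k+1 and 2k+2, because Carlson's bounds for both involve the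
  same sum of |a_j|^2 over j <= k. Summing over k gives (1 - |a_0|^2 - Q) r/(1-r) - Q/(1 + |a_0|),
  where Q is the squared norm; moving the Q terms to the left produces the weight.\<close>

lemma bohr_sum_bound:
  assumes f: "f \<in> schur_class" and r: "0 \<le> r" "r < 1"
  shows "(\<Sum>n. cmod (pcoeff f (Suc n)) * r ^ Suc n)
           + (1 / (1 + cmod (pcoeff f 0)) + r / (1 - r)) * norm_sq (f_minus_const f) r
         \<le> (1 - (cmod (pcoeff f 0))\<^sup>2) * (r / (1 - r))"
proof -
  define \<alpha> where "\<alpha> = cmod (pcoeff f 0)"
  define x where "x = r\<^sup>2"
  define b where "b n = (cmod (pcoeff f n))\<^sup>2" for n
  \<comment> \<open>The value 0 at index 0 separates |a_0|^2 from the squares that make up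
    \<open>Q\<close>.\<close>
  define c where "c n = (if n = 0 then 0 else b n)" for n
  define Q where "Q = norm_sq (f_minus_const f) r"
  have x: "0 \<le> x" "x < 1" using r by (auto simp: x_def abs_square_less_1)
  have Q: "(\<lambda>n. c n * x ^ n) sums Q"
  proof -
    have "summable (\<lambda>n. c n * x ^ n)"
      by (rule summable_comparison_test'[OF schur_class_summable_square[OF f r], of 0])
         (use x in \<open>auto simp: c_def b_def x_def power_mult abs_mult\<close>)
    moreover have "(\<Sum>n. c n * x ^ n) = Q"
      unfolding Q_def norm_sq_f_minus_const[OF f]
      by (rule arg_cong[where f = suminf]) (auto simp: c_def b_def x_def power_mult)
    ultimately show ?thesis by (simp add: sums_iff)
  qed
  have geo: "(\<lambda>n. x ^ n) sums (1 / (1 - x))" using x by (intro geometric_sums) simp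
  \<comment> \<open>Multiplying by the geometric series turns coefficients into their partial sums,
    which is how the Carlson sums assemble.\<close>
  have conv: "(\<lambda>k. (\<Sum>j\<le>k. c j) * x ^ k) sums (Q * (1 / (1 - x)))"
  proof -
    have "summable (\<lambda>n. norm (c n * x ^ n))" "summable (\<lambda>n. norm (x ^ n))"
      using Q geo x by (auto simp: sums_iff abs_mult c_def b_def)
    from Cauchy_product_sums[OF this]
    have "(\<lambda>k. \<Sum>i\<le>k. c i * x ^ i * x ^ (k - i)) sums (Q * (1 / (1 - x)))"
      using Q geo by (simp add: sums_iff)
    moreover have "(\<Sum>i\<le>k. c i * x ^ i * x ^ (k - i)) = (\<Sum>j\<le>k. c j) * x ^ k" for k
      unfolding sum_distrib_right by (rule sum.cong) (auto simp: mult.assoc simp flip: power_add)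
    ultimately show ?thesis by simp
  qed
  have shift: "(\<lambda>n. c (Suc n) * x ^ Suc n) sums Q"
    using Q sums_Suc_iff[of "\<lambda>n. c n * x ^ n" Q] by (simp add: c_def)
  \<comment> \<open>The bound for the \<open>k\<close>-th pair: the weights r^(2k+1) and r^(2k+2)
    add up to \<open>(r + x) * x ^ k\<close>, and the last term is the extra gain of the even
    inequality.\<close>
  define v where "v k = (r + x) * ((1 - \<alpha>\<^sup>2) * x ^ k - (\<Sum>j\<le>k. c j) * x ^ k)
      - c (Suc k) * x ^ Suc k / (1 + \<alpha>)" for k
  have v: "v sums ((r + x) * ((1 - \<alpha>\<^sup>2) * (1 / (1 - x)) - Q * (1 / (1 - x))) - Q / (1 + \<alpha>))"
    unfolding v_def by (intro sums_diff sums_mult sums_divide geo conv shift)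
  define h where "h n = cmod (pcoeff f (Suc n)) * r ^ Suc n" for n
  have "summable h"
    unfolding h_def using schur_class_summable_power[OF f r]
    by (subst summable_Suc_iff)
  \<comment> \<open>As \<open>h\<close> is shifted by one, the block starting at
    \<open>k * 2\<close> holds the coefficients 2k+1 and 2k+2.\<close>
  then have h: "(\<lambda>k. sum h {k * 2..<k * 2 + 2}) sums suminf h"
    by (intro sums_group) (auto simp: summable_sums)
  have "suminf h \<le> (r + x) * ((1 - \<alpha>\<^sup>2) * (1 / (1 - x)) - Q * (1 / (1 - x))) - Q / (1 + \<alpha>)"
  proof (rule sums_le[OF _ h v])
    fix k
    let ?A = "\<Sum>j\<le>k. c j"
    have A: "(\<Sum>j\<le>k. b j) = \<alpha>\<^sup>2 + ?A"
      by (simp add: c_def b_def \<alpha>_def sum.atMost_shift)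
    have "cmod (pcoeff f (2 * k + 1)) \<le> 1 - (\<alpha>\<^sup>2 + ?A)"
      using carlson_odd[OF f, of k] A by (simp add: b_def)
    moreover have "h (k * 2) = cmod (pcoeff f (2 * k + 1)) * (r * x ^ k)"
      by (simp add: h_def x_def mult.commute[of k] flip: power_mult)
    ultimately have 1: "h (k * 2) \<le> (1 - (\<alpha>\<^sup>2 + ?A)) * (r * x ^ k)"
      using r x by (auto intro!: mult_right_mono)
    have "cmod (pcoeff f (2 * Suc k)) \<le> 1 - (\<alpha>\<^sup>2 + ?A) - c (Suc k) / (1 + \<alpha>)"
      using carlson_even[OF f, of "Suc k"] A
      by (simp add: b_def c_def \<alpha>_def lessThan_Suc_atMost)
    moreover have "h (Suc (k * 2)) = cmod (pcoeff f (2 * Suc k)) * x ^ Suc k"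
    proof -
      have "r ^ (2 * Suc k) = x ^ Suc k" unfolding x_def by (rule power_mult)
      moreover have "Suc (Suc (k * 2)) = 2 * Suc k" by simp
      ultimately show ?thesis unfolding h_def by (simp only:)
    qed
    ultimately have 2: "h (Suc (k * 2)) \<le> (1 - (\<alpha>\<^sup>2 + ?A) - c (Suc k) / (1 + \<alpha>)) * x ^ Suc k"
      using x by (auto intro!: mult_right_mono)
    have "sum h {k * 2..<k * 2 + 2} = h (k * 2) + h (Suc (k * 2))"
      by (simp add: numeral_2_eq_2)
    also have "\<dots> \<le> v k" using add_mono[OF 1 2] by (simp add: v_def algebra_simps)
    finally show "sum h {k * 2..<k * 2 + 2} \<le> v k" .
  qed
  also have "(r + x) * ((1 - \<alpha>\<^sup>2) * (1 / (1 - x)) - Q * (1 / (1 - x)))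
      = (r + x) / (1 - x) * (1 - \<alpha>\<^sup>2 - Q)"
    by (simp add: algebra_simps diff_divide_distrib add_divide_distrib)
  also have "(r + x) / (1 - x) = r / (1 - r)"
  proof -
    have "r + x = r * (1 + r)" "1 - x = (1 - r) * (1 + r)"
      by (simp_all add: x_def power2_eq_square algebra_simps)
    then show ?thesis using r by simp
  qed
  finally show ?thesis
    unfolding h_def Q_def[symmetric] \<alpha>_def[symmetric] by (simp add: algebra_simps)
qed

lemma bohr_lhs1_eq:
  assumes f: "f \<in> schur_class" and r: "0 \<le> r" "r < 1"
  shows "bohr_lhs1 f c r = cmod (pcoeff f 0) + (\<Sum>n. cmod (pcoeff f (Suc n)) * r ^ Suc n)
           + (c + r / (1 - r)) * norm_sq (f_minus_const f) r"
  unfolding bohr_lhs1_def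
  using suminf_split_head[OF schur_class_summable_power[OF f r]] by simp

section \<open>The extremal Moebius maps\<close>

text \<open>The map is (z - a)/(1 - a z) = -a + (1 - a^2) z/(1 - a z), and the last fraction is a
  geometric series; the coefficients are then determined by uniqueness of the expansion.\<close>

lemma moebius_pcoeff:
  fixes a :: real
  assumes a: "0 \<le> a" "a < 1"
  shows "pcoeff (Moebius_function 0 a) 0 = - of_real a"
    and "pcoeff (Moebius_function 0 a) (Suc n) = of_real ((1 - a\<^sup>2) * a ^ n)"
proof -
  define F :: "complex fps" where
    "F = Abs_fps (\<lambda>n. case n of 0 \<Rightarrow> - of_real a | Suc n \<Rightarrow> of_real ((1 - a\<^sup>2) * a ^ n))"
  have "(\<lambda>n. fps_nth F n * z ^ n) sums Moebius_function 0 a z" if z: "z \<in> ball 0 1" for z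
  proof -
    let ?w = "of_real a * z"
    have w: "cmod ?w < 1"
      using a z mult_left_le_one_le[of "cmod z" a] by (simp add: norm_mult)
    then have "1 - ?w \<noteq> 0" by auto
    have "(\<lambda>n. of_real (1 - a\<^sup>2) * z * ?w ^ n) sums (of_real (1 - a\<^sup>2) * z * (1 / (1 - ?w)))"
      using w by (intro sums_mult geometric_sums)
    then have "(\<lambda>n. fps_nth F (Suc n) * z ^ Suc n) sums (of_real (1 - a\<^sup>2) * z * (1 / (1 - ?w)))"
      by (simp add: F_def power_mult_distrib mult_ac)
    from sums_Suc[OF this] have "(\<lambda>n. fps_nth F n * z ^ n) sums
        (of_real (1 - a\<^sup>2) * z * (1 / (1 - ?w)) + fps_nth F 0 * z ^ 0)" .
    also have "of_real (1 - a\<^sup>2) * z * (1 / (1 - ?w)) + fps_nth F 0 * z ^ 0 = Moebius_function 0 a z"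
      using \<open>1 - ?w \<noteq> 0\<close>
      by (simp add: F_def Moebius_function_simple divide_simps) (simp add: algebra_simps power2_eq_square)
    finally show ?thesis .
  qed
  then have "eventually (\<lambda>z. (\<lambda>n. fps_nth F n * z ^ n) sums Moebius_function 0 a z) (nhds 0)"
    using eventually_nhds_in_open[of "ball (0::complex) 1" 0] by (auto elim!: eventually_mono)
  then have "Moebius_function 0 a has_fps_expansion F" by (rule has_fps_expansionI)
  from pcoeff_eq_fps_nth[OF this]
  show "pcoeff (Moebius_function 0 a) 0 = - of_real a"
    and "pcoeff (Moebius_function 0 a) (Suc n) = of_real ((1 - a\<^sup>2) * a ^ n)"
    by (simp_all add: F_def)
qed

lemma moebius_schur_class:
  fixes a :: real
  assumes "0 \<le> a" "a < 1"
  shows "Moebius_function 0 a \<in> schur_class"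
  using assms Moebius_function_norm_lt_1[of a] Moebius_function_holomorphic[of a 0]
  by (auto simp: schur_class_def analytic_on_open intro: less_imp_le)

lemma moebius_norm_sq:
  fixes a r :: real
  assumes a: "0 \<le> a" "a < 1" and r: "0 \<le> r" "r < 1"
  shows "norm_sq (f_minus_const (Moebius_function 0 a)) r = ((1 - a\<^sup>2) * r)\<^sup>2 / (1 - (a * r)\<^sup>2)"
proof -
  have ar: "a * r < 1" "0 \<le> a * r"
    using a r mult_right_mono[of a 1 r] by auto
  have "(\<lambda>n. ((1 - a\<^sup>2) * r)\<^sup>2 * ((a * r)\<^sup>2) ^ n) sums (((1 - a\<^sup>2) * r)\<^sup>2 * (1 / (1 - (a * r)\<^sup>2)))"
    using ar by (intro sums_mult geometric_sums) (simp add: abs_square_less_1)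
  moreover have "((1 - a\<^sup>2) * r)\<^sup>2 * ((a * r)\<^sup>2) ^ n =
      (if Suc n = 0 then 0 else (cmod (pcoeff (Moebius_function 0 a) (Suc n)))\<^sup>2 * r ^ (2 * Suc n))" for n
    unfolding moebius_pcoeff[OF a] norm_of_real power2_abs
    by (simp add: power_mult_distrib power_add flip: power_mult) (simp add: power2_eq_square mult_ac)
  ultimately have "(\<lambda>n. if Suc n = 0 then 0 else
      (cmod (pcoeff (Moebius_function 0 a) (Suc n)))\<^sup>2 * r ^ (2 * Suc n)) sums
      (((1 - a\<^sup>2) * r)\<^sup>2 / (1 - (a * r)\<^sup>2))"
    by simp
  from sums_Suc[OF this] show ?thesis
    by (simp add: norm_sq_f_minus_const[OF moebius_schur_class[OF a]] sums_iff)
qed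

text \<open>At \<open>c = 1 / (1 + a)\<close> this is equality in \<open>bohr_sum_bound\<close>.
  Keeping \<open>c\<close> free isolates the effect of a larger constant as a multiple of the
  squared norm.\<close>

lemma moebius_bohr_sum:
  fixes a r c :: real
  assumes a: "0 \<le> a" "a < 1" and r: "0 \<le> r" "r < 1"
  defines "f \<equiv> Moebius_function 0 a"
  shows "(\<Sum>n. cmod (pcoeff f (Suc n)) * r ^ Suc n) + (c + r / (1 - r)) * norm_sq (f_minus_const f) r
         = (1 - a\<^sup>2) * (r / (1 - r)) + (c - 1 / (1 + a)) * norm_sq (f_minus_const f) r"
proof -
  have ar: "a * r < 1" "0 \<le> a * r"
    using a r mult_right_mono[of a 1 r] by auto
  have a2: "a\<^sup>2 \<le> 1" using a by (simp add: power_le_one)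
  have "(\<lambda>n. (1 - a\<^sup>2) * r * (a * r) ^ n) sums ((1 - a\<^sup>2) * r * (1 / (1 - a * r)))"
    using ar by (intro sums_mult geometric_sums) simp
  moreover have "(1 - a\<^sup>2) * r * (a * r) ^ n = cmod (pcoeff f (Suc n)) * r ^ Suc n" for n
    unfolding f_def moebius_pcoeff[OF a] norm_of_real
    using a a2 by (simp add: abs_mult power_mult_distrib mult_ac)
  ultimately have S: "(\<Sum>n. cmod (pcoeff f (Suc n)) * r ^ Suc n) = (1 - a\<^sup>2) * r / (1 - a * r)"
    by (simp add: sums_iff)
  define Q where "Q = norm_sq (f_minus_const f) r"
  have Q: "Q = ((1 - a\<^sup>2) * r)\<^sup>2 / (1 - (a * r)\<^sup>2)"
    unfolding Q_def f_def by (rule moebius_norm_sq) fact+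
  \<comment> \<open>The numerator \<open>1 + a * r\<close> cancels a factor of the denominator of
    \<open>Q\<close>, leaving a fraction that combines with \<open>S\<close>.\<close>
  have "1 / (1 + a) + r / (1 - r) = (1 + a * r) / ((1 + a) * (1 - r))"
    using a r by (simp add: divide_simps) (simp add: algebra_simps)
  moreover have "Q = (1 - a)\<^sup>2 * (1 + a)\<^sup>2 * r\<^sup>2 / ((1 - a * r) * (1 + a * r))"
    unfolding Q by (simp add: power2_eq_square algebra_simps)
  ultimately have "(1 / (1 + a) + r / (1 - r)) * Q = (1 + a * r) / ((1 + a) * (1 - r))
      * ((1 - a)\<^sup>2 * (1 + a)\<^sup>2 * r\<^sup>2 / ((1 - a * r) * (1 + a * r)))"
    by (simp only:)
  moreover have "\<dots> = (1 - a)\<^sup>2 * (1 + a) * r\<^sup>2 / ((1 - r) * (1 - a * r))"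
  proof -
    have "1 + a \<noteq> 0" "1 + a * r \<noteq> 0" "1 - a * r \<noteq> 0" "1 - r \<noteq> 0" using a r ar by linarith+
    then show ?thesis by (simp add: frac_eq_eq) (simp add: power2_eq_square mult_ac)
  qed
  moreover have "(1 - a\<^sup>2) * r / (1 - a * r) + (1 - a)\<^sup>2 * (1 + a) * r\<^sup>2 / ((1 - r) * (1 - a * r))
      = (1 - a\<^sup>2) * (r / (1 - r))"
    using a r ar by (simp add: divide_simps) (simp add: power2_eq_square algebra_simps)
  ultimately have "(1 - a\<^sup>2) * r / (1 - a * r) + (1 / (1 + a) + r / (1 - r)) * Q
      = (1 - a\<^sup>2) * (r / (1 - r))" by simp
  then show ?thesis unfolding S Q_def[symmetric] by (simp add: algebra_simps)
qed

section \<open>Bohr radii\<close>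

text \<open>The function r/(1-r) increases and equals 1/c at r = 1/(1+c). The choice c = 1 + |a_0|
  yields the first Bohr radius, c = 1 the second.\<close>

lemma divide_one_minus_le:
  fixes r c :: real
  assumes "c > 0" "r \<le> 1 / (1 + c)"
  shows "r / (1 - r) \<le> 1 / c"
proof -
  have "r * (1 + c) \<le> 1" using assms by (simp add: pos_le_divide_eq)
  moreover have "r < 1" using assms by (auto intro: le_less_trans)
  ultimately show ?thesis using assms by (simp add: divide_simps algebra_simps)
qed

lemma less_divide_one_minus:
  fixes r c :: real
  assumes "c > 0" "1 / (1 + c) < r" "r < 1"
  shows "1 / c < r / (1 - r)"
proof -
  have "1 < r * (1 + c)" using assms by (simp add: pos_divide_less_eq)
  then show ?thesis using assms by (simp add: divide_simps algebra_simps)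
qed

lemma one_minus_square_div:
  fixes a :: real
  assumes "0 \<le> a"
  shows "(1 - a\<^sup>2) * (1 / (1 + a)) = 1 - a"
  using assms by (simp add: divide_simps) (simp add: power2_eq_square algebra_simps)

text \<open>Up to this radius r/(1-r) <= 1/(1 + |a_0|), so the general bound is at most 1 - |a_0|,
  exactly the room left by the constant term.\<close>

lemma bohr_lhs1_le_1:
  assumes f: "f \<in> schur_class" and r: "0 \<le> r" "r \<le> 1 / (2 + cmod (pcoeff f 0))"
  shows "bohr_lhs1 f (1 / (1 + cmod (pcoeff f 0))) r \<le> 1"
proof -
  define \<alpha> where "\<alpha> = cmod (pcoeff f 0)"
  have \<alpha>: "0 \<le> \<alpha>" "\<alpha> \<le> 1" by (simp_all add: \<alpha>_def schur_class_pcoeff_le_1[OF f])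
  have "r < 1" using r by (auto simp: \<alpha>_def[symmetric] intro!: le_less_trans[OF r(2)]) (use \<alpha> in simp)
  have "r / (1 - r) \<le> 1 / (1 + \<alpha>)"
  proof (rule divide_one_minus_le)
    show "0 < 1 + \<alpha>" using \<alpha> by simp
    show "r \<le> 1 / (1 + (1 + \<alpha>))" using r(2) by (simp add: \<alpha>_def add.assoc[symmetric])
  qed
  then have "(1 - \<alpha>\<^sup>2) * (r / (1 - r)) \<le> (1 - \<alpha>\<^sup>2) * (1 / (1 + \<alpha>))"
    using \<alpha> by (intro mult_left_mono) (auto simp: power_le_one)
  also have "\<dots> = 1 - \<alpha>" by (rule one_minus_square_div[OF \<alpha>(1)])
  finally show ?thesis
    using bohr_sum_bound[OF f r(1) \<open>r < 1\<close>]
    unfolding bohr_lhs1_eq[OF f r(1) \<open>r < 1\<close>] \<alpha>_def by linarith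
qed

text \<open>Up to 1/2 the ratio r/(1-r) is at most 1, and the general bound leaves room for
  |a_0|^2.\<close>

lemma bohr_lhs2_le_1:
  assumes f: "f \<in> schur_class" and r: "0 \<le> r" "r \<le> 1 / 2"
  shows "bohr_lhs2 f (1 / (1 + cmod (pcoeff f 0))) r \<le> 1"
proof -
  define \<alpha> where "\<alpha> = cmod (pcoeff f 0)"
  have \<alpha>: "0 \<le> \<alpha>" "\<alpha> \<le> 1" by (simp_all add: \<alpha>_def schur_class_pcoeff_le_1[OF f])
  have "r < 1" using r by simp
  have "r / (1 - r) \<le> 1" using divide_one_minus_le[of 1 r] r by simp
  then have "(1 - \<alpha>\<^sup>2) * (r / (1 - r)) \<le> (1 - \<alpha>\<^sup>2) * 1"
    using \<alpha> by (intro mult_left_mono) (auto simp: power_le_one)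
  also have "\<dots> = 1 - \<alpha>\<^sup>2" by simp
  finally show ?thesis
    using bohr_sum_bound[OF f r(1) \<open>r < 1\<close>] unfolding bohr_lhs2_def \<alpha>_def by linarith
qed

text \<open>This shows both ways to exceed 1: a radius beyond the critical one makes the middle term
  too large, and a larger constant makes the last term positive.\<close>

lemma moebius_bohr_lhs1:
  fixes a r c :: real
  assumes a: "0 \<le> a" "a < 1" and r: "0 \<le> r" "r < 1"
  shows "bohr_lhs1 (Moebius_function 0 a) c r = a + (1 - a\<^sup>2) * (r / (1 - r))
           + (c - 1 / (1 + a)) * norm_sq (f_minus_const (Moebius_function 0 a)) r"
  using bohr_lhs1_eq[OF moebius_schur_class[OF a] r] moebius_bohr_sum[OF a r] a
  by (simp add: moebius_pcoeff(1))

lemma moebius_bohr_lhs2: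
  fixes a r c :: real
  assumes a: "0 \<le> a" "a < 1" and r: "0 \<le> r" "r < 1"
  shows "bohr_lhs2 (Moebius_function 0 a) c r = a\<^sup>2 + (1 - a\<^sup>2) * (r / (1 - r))
           + (c - 1 / (1 + a)) * norm_sq (f_minus_const (Moebius_function 0 a)) r"
  using moebius_bohr_sum[OF a r] a by (simp add: bohr_lhs2_def moebius_pcoeff(1))

text \<open>Strict positivity ensures that any excess of the constant over
  \<open>1 / (1 + a)\<close>, however small, breaks the inequality.\<close>

lemma moebius_norm_sq_pos:
  fixes a r :: real
  assumes a: "0 \<le> a" "a < 1" and r: "0 < r" "r < 1"
  shows "norm_sq (f_minus_const (Moebius_function 0 a)) r > 0"
proof -
  have "a * r \<le> 1 * r" using a r by (intro mult_right_mono) auto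
  then have "a * r < 1" using r by linarith
  moreover have "0 \<le> a * r" using a r by simp
  ultimately have "(a * r)\<^sup>2 < 1" by (simp add: abs_square_less_1)
  moreover have "1 - a\<^sup>2 > 0" using a by (simp add: abs_square_less_1)
  ultimately show ?thesis using a r by (subst moebius_norm_sq) auto
qed

theorem theorem2:
  shows
    "(\<forall>f\<in>schur_class. \<forall>r\<in>{0..1 / (2 + cmod (pcoeff f 0))}.
        bohr_lhs1 f (1 / (1 + cmod (pcoeff f 0))) r \<le> 1)
     \<and> (\<forall>a\<in>{0..<1::real}. \<forall>R\<in>{1 / (2 + a)<..<1}.
        \<exists>f\<in>schur_class. cmod (pcoeff f 0) = a \<and>
          (\<exists>r\<in>{0..R}. \<not> bohr_lhs1 f (1 / (1 + cmod (pcoeff f 0))) r \<le> 1))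
     \<and> (\<forall>a\<in>{0..<1::real}. \<forall>l>1 / (1 + a).
        \<exists>f\<in>schur_class. cmod (pcoeff f 0) = a \<and>
          (\<exists>r\<in>{0..1 / (2 + a)}. \<not> bohr_lhs1 f l r \<le> 1))
     \<and> (\<forall>f\<in>schur_class. \<forall>r\<in>{0..1 / 2}.
        bohr_lhs2 f (1 / (1 + cmod (pcoeff f 0))) r \<le> 1)
     \<and> (\<forall>R\<in>{1 / 2<..<1}.
        \<exists>f\<in>schur_class. \<exists>r\<in>{0..R}. \<not> bohr_lhs2 f (1 / (1 + cmod (pcoeff f 0))) r \<le> 1)
     \<and> (\<forall>a\<in>{0..<1::real}. \<forall>l>1 / (1 + a).
        \<exists>f\<in>schur_class. cmod (pcoeff f 0) = a \<and>
          (\<exists>r\<in>{0..1 / 2}. \<not> bohr_lhs2 f l r \<le> 1))"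
proof (intro conjI ballI allI impI)
  fix f r assume "f \<in> schur_class" "r \<in> {0..1 / (2 + cmod (pcoeff f 0))}"
  then show "bohr_lhs1 f (1 / (1 + cmod (pcoeff f 0))) r \<le> 1"
    by (intro bohr_lhs1_le_1) auto
next
  fix f r assume "f \<in> schur_class" "r \<in> {0..1 / 2 :: real}"
  then show "bohr_lhs2 f (1 / (1 + cmod (pcoeff f 0))) r \<le> 1"
    by (intro bohr_lhs2_le_1) auto
next
  fix a R :: real assume "a \<in> {0..<1}" and R: "R \<in> {1 / (2 + a)<..<1}"
  then have a: "0 \<le> a" "a < 1" by auto
  let ?f = "Moebius_function 0 a"
  have "0 < 1 / (2 + a)" using a by simp
  moreover have "1 / (2 + a) < R" using R by simp
  ultimately have "0 < R" by (rule less_trans)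
  then have R0: "0 \<le> R" "R < 1" using R by auto
  have f0: "cmod (pcoeff ?f 0) = a" using a by (simp add: moebius_pcoeff(1))
  \<comment> \<open>The failure occurs at the endpoint \<open>r = R\<close>, with the constant left
    unchanged.\<close>
  have "1 / (1 + a) < R / (1 - R)"
    using less_divide_one_minus[of "1 + a" R] R a by (simp add: add.assoc[symmetric])
  moreover have "1 - a\<^sup>2 > 0" using a by (simp add: abs_square_less_1)
  ultimately have "(1 - a\<^sup>2) * (1 / (1 + a)) < (1 - a\<^sup>2) * (R / (1 - R))"
    by (rule mult_strict_left_mono)
  moreover have "(1 - a\<^sup>2) * (1 / (1 + a)) = 1 - a"
    by (rule one_minus_square_div[OF a(1)])
  ultimately have "\<not> bohr_lhs1 ?f (1 / (1 + a)) R \<le> 1"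
    unfolding moebius_bohr_lhs1[OF a R0] by simp
  then show "\<exists>f\<in>schur_class. cmod (pcoeff f 0) = a \<and>
      (\<exists>r\<in>{0..R}. \<not> bohr_lhs1 f (1 / (1 + cmod (pcoeff f 0))) r \<le> 1)"
    using moebius_schur_class[OF a] f0 R0 by (intro bexI[of _ ?f]) auto
next
  fix a l :: real assume "a \<in> {0..<1}" and l: "l > 1 / (1 + a)"
  then have a: "0 \<le> a" "a < 1" by auto
  let ?f = "Moebius_function 0 a"
  \<comment> \<open>At the critical radius the unmodified left-hand side is already exactly
    1.\<close>
  define r where "r = 1 / (2 + a)"
  have r: "0 < r" "0 \<le> r" "r < 1" using a by (simp_all add: r_def)
  have f0: "cmod (pcoeff ?f 0) = a" using a by (simp add: moebius_pcoeff(1))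
  have "r / (1 - r) = 1 / (1 + a)" using a by (simp add: r_def divide_simps)
  then have "(1 - a\<^sup>2) * (r / (1 - r)) = 1 - a"
    using one_minus_square_div[OF a(1)] by (simp only:)
  moreover have "(l - 1 / (1 + a)) * norm_sq (f_minus_const ?f) r > 0"
    using l moebius_norm_sq_pos[OF a r(1,3)] by (intro mult_pos_pos) auto
  ultimately have "\<not> bohr_lhs1 ?f l r \<le> 1"
    unfolding moebius_bohr_lhs1[OF a r(2,3)] by simp
  then show "\<exists>f\<in>schur_class. cmod (pcoeff f 0) = a \<and>
      (\<exists>r\<in>{0..1 / (2 + a)}. \<not> bohr_lhs1 f l r \<le> 1)"
    using moebius_schur_class[OF a] f0 r by (intro bexI[of _ ?f]) (auto simp: r_def)
next
  fix R :: real assume R: "R \<in> {1 / 2<..<1}"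
  \<comment> \<open>No value of |a_0| is prescribed here, so the identity map serves: the left-hand
    side is R/(1-R).\<close>
  let ?f = "Moebius_function 0 (of_real 0)"
  have R0: "0 \<le> R" "R < 1" using R by auto
  have "1 < R / (1 - R)" using less_divide_one_minus[of 1 R] R by simp
  then have "\<not> bohr_lhs2 ?f (1 / (1 + cmod (pcoeff ?f 0))) R \<le> 1"
    using moebius_pcoeff(1)[of 0] moebius_bohr_lhs2[of 0 R 1] R0 by simp
  then show "\<exists>f\<in>schur_class. \<exists>r\<in>{0..R}. \<not> bohr_lhs2 f (1 / (1 + cmod (pcoeff f 0))) r \<le> 1"
    using moebius_schur_class[of 0] R0 by (intro bexI[of _ ?f] bexI[of _ R]) auto
next
  fix a l :: real assume "a \<in> {0..<1}" and l: "l > 1 / (1 + a)"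
  then have a: "0 \<le> a" "a < 1" by auto
  let ?f = "Moebius_function 0 a"
  have f0: "cmod (pcoeff ?f 0) = a" using a by (simp add: moebius_pcoeff(1))
  \<comment> \<open>At r = 1/2 the other terms give a^2 + (1 - a^2) = 1, so this excess
    decides.\<close>
  have "(l - 1 / (1 + a)) * norm_sq (f_minus_const ?f) (1 / 2) > 0"
    using l moebius_norm_sq_pos[OF a, of "1 / 2"] by (intro mult_pos_pos) auto
  then have "\<not> bohr_lhs2 ?f l (1 / 2) \<le> 1"
    using moebius_bohr_lhs2[OF a, of "1 / 2" l] by simp
  then show "\<exists>f\<in>schur_class. cmod (pcoeff f 0) = a \<and>
      (\<exists>r\<in>{0..1 / 2}. \<not> bohr_lhs2 f l r \<le> 1)"
    using moebius_schur_class[OF a] f0 by (intro bexI[of _ ?f] conjI bexI[of _ "1 / 2"]) auto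
qed

end
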